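(* Let $G$ be a simple graph on $n$ vertices such that either every vertex has odd degree or every vertex has even degree (zero allowed). Then: (a) in the Neighborhood Lights Out game on $G$, every state $x\in\mathbb F_2^n$ can be transformed into its inverse state $x+(1,\dots,1)^\top$; (b) if every vertex of $G$ has odd degree, then whenever an initial state $i$ can be transformed into a final state $f$ in the Neighborhood Lights Out game on $G$, $i$ can also be transformed into $f$ in the original Lights Out game on $G$.
   Context: Original Lights Out game on $G$ (vertices $v_1,\dots,v_n$): a state is $x\in\mathbb F_2^n$; pressing the button at $v_j$ toggles the light at $v_j$ and at all its neighbours. Neighborhood Lights Out game on $G$: pressing the button at $v_i$ toggles the light at $v_i$ and at each vertex $v_k\neq v_i$ joined to $v_i$ by an odd total number of paths of length $1$ or $2$ (others keep their status). Arithmetic over $\mathbb F_2$. A state $i$ can be transformed into $f$ if some finite sequence of button presses turns $i$ into $f$. *)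

theory Defs
  imports "HOL-Library.Z2" "HOL-Analysis.Finite_Cartesian_Product"
begin

text \<open>
  A simple graph on \<open>n\<close> vertices is given by its adjacency relation on a finite vertex type
  \<open>'n\<close> with \<open>n = CARD('n)\<close>; states are vectors over the two-element field \<^typ>\<open>bit\<close>.
\<close>

definition simple_graph :: "('n::finite \<Rightarrow> 'n \<Rightarrow> bool) \<Rightarrow> bool" where
  "simple_graph E \<longleftrightarrow> symp E \<and> irreflp E"

definition vertex_degree :: "('n::finite \<Rightarrow> 'n \<Rightarrow> bool) \<Rightarrow> 'n \<Rightarrow> nat" where
  "vertex_degree E v = card {w. E v w}"

text \<open>
  Paths are vertex lists without repetition. They are taken from \<open>u\<close> to \<open>v\<close>, so each undirected
  path joining the two vertices is counted once. The length is the number of edges.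
\<close>

definition paths :: "('n::finite \<Rightarrow> 'n \<Rightarrow> bool) \<Rightarrow> nat \<Rightarrow> 'n \<Rightarrow> 'n \<Rightarrow> 'n list set" where
  "paths E l u v =
     {p. length p = l + 1 \<and> hd p = u \<and> last p = v \<and> distinct p \<and> successively E p}"

definition toggle :: "'n set \<Rightarrow> bit ^ 'n \<Rightarrow> bit ^ 'n::finite" where
  "toggle S x = (\<chi> v. if v \<in> S then x $ v + 1 else x $ v)"

definition original_press :: "('n::finite \<Rightarrow> 'n \<Rightarrow> bool) \<Rightarrow> 'n \<Rightarrow> bit ^ 'n \<Rightarrow> bit ^ 'n" where
  "original_press E j = toggle ({j} \<union> {k. E j k})"

definition neighborhood_press :: "('n::finite \<Rightarrow> 'n \<Rightarrow> bool) \<Rightarrow> 'n \<Rightarrow> bit ^ 'n \<Rightarrow> bit ^ 'n" where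
  "neighborhood_press E i =
     toggle ({i} \<union> {k. k \<noteq> i \<and> odd (card (paths E 1 i k \<union> paths E 2 i k))})"

definition transformable :: "('n::finite \<Rightarrow> bit ^ 'n \<Rightarrow> bit ^ 'n) \<Rightarrow> bit ^ 'n \<Rightarrow> bit ^ 'n \<Rightarrow> bool" where
  "transformable press x y \<longleftrightarrow> (\<exists>js. fold press js x = y)"

end

theory Submission
  imports Defs "HOL-Analysis.Cartesian_Space"
begin

text \<open>
  Each press adds a fixed vector, so reachability means that the difference of the states lies in
  the span of the press vectors. The neighborhood press matrix \<open>N\<close> is symmetric with ones on its
  diagonal. If \<open>y\<close> is orthogonal to all columns of \<open>N\<close>, then \<open>0 = y\<^sup>T N y = \<Sum>i. y\<^sub>i\<close>,
  because the off-diagonal terms cancel in pairs; hence the all-ones vector lies in the column space.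
  If all degrees are odd and \<open>A\<close> is the adjacency matrix, then \<open>A\<^sup>2\<close> has ones on its diagonal,
  so \<open>N = A + A\<^sup>2 = (I + A) A\<close>: a neighborhood press at \<open>i\<close> amounts to original presses at
  all neighbours of \<open>i\<close>.
\<close>

text \<open>Adjoining \<open>b\<close> to a maximal independent subset of \<open>S\<close> keeps it
  independent, so some linear map kills \<open>S\<close> but not \<open>b\<close>; a row of its
  matrix supplies the coefficients.\<close>

lemma separating_coefficients:
  fixes b :: "'a::field ^ 'n::finite"
  assumes "b \<notin> vec.span S"
  obtains y where "\<And>v. v \<in> S \<Longrightarrow> (\<Sum>i\<in>UNIV. y i * v $ i) = 0" "(\<Sum>i\<in>UNIV. y i * b $ i) = 1"
proof -
  obtain B where B: "B \<subseteq> S" "vec.independent B" "S \<subseteq> vec.span B"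
    by (rule vec.maximal_independent_subset)
  have b: "b \<notin> vec.span B"
    using assms vec.span_mono[OF B(1)] by blast
  then have "vec.independent (insert b B)"
    using B(2) by (rule vec.independent_insertI)
  then obtain g :: "'a ^ 'n \<Rightarrow> 'a ^ 'n" where g: "Vector_Spaces.linear (*s) (*s) g"
    "\<And>x. x \<in> insert b B \<Longrightarrow> g x = (if x = b then 1 else 0)"
    using vec.linear_independent_extend[of "insert b B" "\<lambda>x. if x = b then 1 else 0"] by blast
  have gB: "g v = 0" if "v \<in> S" for v
  proof (rule vec.linear_eq_0_on_span[OF g(1)])
    show "v \<in> vec.span B" using that B(3) by blast
    show "g x = 0" if "x \<in> B" for x
      using that b g(2)[of x] vec.span_base[of x B] by auto
  qed
  \<comment> \<open>Any row will do: \<open>g b\<close> is the vector \<open>1\<close>, all of whose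
    coordinates are 1.\<close>
  fix u :: 'n
  have coeff: "(\<Sum>i\<in>UNIV. matrix g $ u $ i * v $ i) = g v $ u" for v
    unfolding matrix_works[OF g(1), of v, symmetric] by (simp add: matrix_vector_mult_def)
  show thesis
    by (rule that[of "\<lambda>i. matrix g $ u $ i"]) (use gB g(2)[of b] in \<open>simp_all add: coeff\<close>)
qed

lemma bit_add_self [simp]: "(b::bit) + b = 0"
  by (cases b) auto

lemma of_nat_bit_eq: "(of_nat n :: bit) = of_bool (odd n)"
  by (induction n) (auto simp del: add_bit_eq_xor)

lemma bit_sum_symmetric_eq_sum_diagonal:
  fixes f :: "'a \<Rightarrow> 'a \<Rightarrow> bit"
  assumes "finite A" "\<And>i j. f i j = f j i"
  shows "(\<Sum>i\<in>A. \<Sum>j\<in>A. f i j) = (\<Sum>i\<in>A. f i i)"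
  using assms(1)
proof (induction A rule: finite_induct)
  case (insert a A)
  \<comment> \<open>By symmetry the new row and the new column contribute the same off-diagonal sum
    \<open>?r\<close>, and \<open>?r + ?r\<close> vanishes in characteristic 2.\<close>
  let ?r = "\<Sum>j\<in>A. f a j"
  have "(\<Sum>i\<in>A. f i a) = ?r"
    by (simp add: assms(2)[of _ a])
  then have "(\<Sum>i\<in>insert a A. \<Sum>j\<in>insert a A. f i j)
      = (f a a + (\<Sum>i\<in>A. f i i)) + (?r + ?r)"
    using insert by (simp only: sum.insert sum.distrib ac_simps simp_thms)
  then show ?case
    using insert by (simp only: sum.insert bit_add_self add_0_right simp_thms)
qed simp

text \<open>Sutner's theorem, for an arbitrary reflexive symmetric relation.\<close>

lemma all_ones_in_span:
  fixes R :: "'n::finite \<Rightarrow> 'n \<Rightarrow> bool"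
  assumes "symp R" "reflp R"
  shows "(\<chi> v. 1) \<in> vec.span (range (\<lambda>i. (\<chi> k. of_bool (R i k)) :: bit ^ 'n))"
proof (rule ccontr)
  assume "\<not> ?thesis"
  then obtain y where
    orth: "\<And>v. v \<in> range (\<lambda>i. (\<chi> k. of_bool (R i k)) :: bit ^ 'n) \<Longrightarrow> (\<Sum>k\<in>UNIV. y k * v $ k) = 0" and
    one: "(\<Sum>k\<in>UNIV. y k * (\<chi> v. 1) $ k) = 1"
    by (rule separating_coefficients) blast
  have y: "(\<Sum>k\<in>UNIV. y k * of_bool (R i k)) = 0" for i
    using orth[OF rangeI, of i] by (simp only: vec_lambda_beta)
  \<comment> \<open>Squaring is the identity on the two-element field, so by reflexivity the sum of
    \<open>y\<close> is the diagonal part of the quadratic form of \<open>R\<close> at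
    \<open>y\<close>.\<close>
  have "(\<Sum>k\<in>UNIV. y k) = (\<Sum>k\<in>UNIV. y k * (y k * of_bool (R k k)))"
  proof (rule sum.cong)
    show "y k = y k * (y k * of_bool (R k k))" for k
      using reflpD[OF assms(2), of k] by (cases "y k") auto
  qed simp
  also have "\<dots> = (\<Sum>i\<in>UNIV. \<Sum>k\<in>UNIV. y i * (y k * of_bool (R i k)))"
  proof (rule bit_sum_symmetric_eq_sum_diagonal[where f = "\<lambda>i k. y i * (y k * of_bool (R i k))", symmetric])
    fix i k
    have "R i k = R k i"
      using sympD[OF assms(1)] by blast
    then show "y i * (y k * of_bool (R i k)) = y k * (y i * of_bool (R k i))"
      by (simp add: mult.left_commute del: mult_bit_eq_and)
  qed simp
  also have "\<dots> = 0"
    by (simp add: sum_distrib_left[symmetric] y del: mult_bit_eq_and)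
  finally show False
    using one by (simp del: mult_bit_eq_and)
qed

lemma toggle_eq_add: "toggle S x = x + (\<chi> v. of_bool (v \<in> S))"
  by (simp add: toggle_def vec_eq_iff del: add_bit_eq_xor)

lemma fold_add_eq_sum_list: "fold (\<lambda>i x. x + c i) js x = x + sum_list (map c js)"
  for x :: "'a::comm_monoid_add"
  by (induction js arbitrary: x) (simp_all add: ac_simps)

text \<open>The only scalars are 0 and 1, so a linear combination of press vectors is just a sum
  over a list of presses.\<close>

lemma transformable_toggle_iff:
  fixes S :: "'n::finite \<Rightarrow> 'n set"
  shows "transformable (\<lambda>i. toggle (S i)) x y
    \<longleftrightarrow> y - x \<in> vec.span (range (\<lambda>i. \<chi> v. of_bool (v \<in> S i)))"
proof -
  define c :: "'n \<Rightarrow> bit ^ 'n" where "c = (\<lambda>i. \<chi> v. of_bool (v \<in> S i))"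
  have "z \<in> vec.span (range c) \<longleftrightarrow> (\<exists>js. z = sum_list (map c js))" for z
  proof
    assume "z \<in> vec.span (range c)"
    then show "\<exists>js. z = sum_list (map c js)"
    proof (induction rule: vec.span_induct_alt)
      case base
      show ?case by (rule exI[of _ "[]"]) simp
    next
      case (step a v w)
      then obtain i js where "v = c i" "w = sum_list (map c js)" by blast
      then show ?case
        \<comment> \<open>Scalar 0 leaves the list unchanged; scalar 1 adds one press of
          \<open>i\<close>.\<close>
        by (cases a) (auto intro: exI[of _ js] exI[of _ "i # js"])
    qed
  next
    have "sum_list (map c js) \<in> vec.span (range c)" for js
      by (induction js) (auto intro: vec.span_zero vec.span_add vec.span_base)
    then show "\<exists>js. z = sum_list (map c js) \<Longrightarrow> z \<in> vec.span (range c)" by blast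
  qed
  moreover have "(\<lambda>i. toggle (S i)) = (\<lambda>i x. x + c i)"
    by (simp add: fun_eq_iff toggle_eq_add c_def)
  moreover have "fold (\<lambda>i x. x + c i) js x = y \<longleftrightarrow> y - x = sum_list (map c js)" for js
    unfolding fold_add_eq_sum_list by (metis add_diff_cancel_left' diff_add_cancel add.commute)
  ultimately show ?thesis
    unfolding transformable_def c_def[symmetric] by simp
qed

lemma paths_one: "i \<noteq> k \<Longrightarrow> paths E 1 i k = (if E i k then {[i, k]} else {})"
  by (auto simp: paths_def length_Suc_conv)

text \<open>The middle vertex determines the path. Irreflexivity and \<open>i \<noteq> k\<close>
  make the three vertices distinct.\<close>

lemma paths_two:
  assumes "irreflp E" "i \<noteq> k"
  shows "paths E 2 i k = (\<lambda>j. [i, j, k]) ` {j. E i j \<and> E j k}"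
  using assms by (auto simp: paths_def length_Suc_conv numeral_2_eq_2 irreflp_def)

lemma card_paths_one_two:
  assumes "irreflp E" "i \<noteq> k"
  shows "card (paths E 1 i k \<union> paths E 2 i k) = of_bool (E i k) + card {j. E i j \<and> E j k}"
proof -
  have "card (paths E 1 i k \<union> paths E 2 i k) = card (paths E 1 i k) + card (paths E 2 i k)"
    by (rule card_Un_disjoint) (auto simp: paths_one paths_two assms simp del: One_nat_def)
  also have "card (paths E 2 i k) = card {j. E i j \<and> E j k}"
    unfolding paths_two[OF assms] by (rule card_image) (auto simp: inj_on_def)
  finally show ?thesis
    by (simp add: paths_one assms(2) del: One_nat_def)
qed

text \<open>Off the diagonal this is \<open>A + A\<^sup>2\<close> modulo 2, with \<open>A\<close>
  the adjacency matrix. The disjunct \<open>k = i\<close> forces ones on the diagonal, as a press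
  always toggles its own light.\<close>

definition neighborhood_rel :: "('n::finite \<Rightarrow> 'n \<Rightarrow> bool) \<Rightarrow> 'n \<Rightarrow> 'n \<Rightarrow> bool" where
  "neighborhood_rel E i k \<longleftrightarrow> k = i \<or> odd (of_bool (E i k) + card {j. E i j \<and> E j k})"

lemma neighborhood_press_eq:
  assumes "irreflp E"
  shows "neighborhood_press E = (\<lambda>i. toggle {k. neighborhood_rel E i k})"
proof
  fix i
  have "{i} \<union> {k. k \<noteq> i \<and> odd (card (paths E 1 i k \<union> paths E 2 i k))} = {k. neighborhood_rel E i k}"
    using card_paths_one_two[OF assms] unfolding neighborhood_rel_def by fastforce
  then show "neighborhood_press E i = toggle {k. neighborhood_rel E i k}"
    by (simp only: neighborhood_press_def)
qed

lemma symp_neighborhood_rel: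
  assumes "symp E"
  shows "symp (neighborhood_rel E)"
proof (rule sympI)
  fix i k
  have "E a b \<longleftrightarrow> E b a" for a b
    using sympD[OF assms] by blast
  then have "E i k = E k i" "{j. E i j \<and> E j k} = {j. E k j \<and> E j i}"
    by blast+
  then show "neighborhood_rel E i k \<Longrightarrow> neighborhood_rel E k i"
    by (simp only: neighborhood_rel_def) (simp only: eq_commute[of i k])
qed

lemma original_press_eq: "original_press E = (\<lambda>j. toggle {k. k = j \<or> E j k})"
  by (auto simp: original_press_def fun_eq_iff intro!: arg_cong2[of _ _ _ _ toggle])

text \<open>Row \<open>i\<close> of \<open>A (I + A)\<close>: the rows of \<open>I + A\<close> at
  the neighbours of \<open>i\<close> are added up.\<close>

lemma neighborhood_vector_eq_sum:
  fixes E :: "'n::finite \<Rightarrow> 'n \<Rightarrow> bool"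
  assumes "symp E" "irreflp E" "odd (vertex_degree E i)"
  shows "((\<chi> k. of_bool (neighborhood_rel E i k)) :: bit ^ 'n)
    = (\<Sum>j\<in>{j. E i j}. \<chi> k. of_bool (k = j \<or> E j k))"
proof -
  have "of_bool (neighborhood_rel E i k) = (\<Sum>j\<in>{j. E i j}. of_bool (k = j \<or> E j k) :: bit)" for k
  proof -
    \<comment> \<open>A neighbour \<open>j\<close> of \<open>i\<close> counts either as the endpoint
      of the edge from \<open>i\<close> to \<open>k\<close> or as the midpoint of a walk of length
      2, never as both, since there are no loops.\<close>
    have "{j. E i j} \<inter> {j. k = j \<or> E j k} = {j. j = k \<and> E i k} \<union> {j. E i j \<and> E j k}"
      by auto
    moreover have "card \<dots> = card {j. j = k \<and> E i k} + card {j. E i j \<and> E j k}"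
      using assms(2) by (intro card_Un_disjoint) (auto simp: irreflp_def)
    moreover have "card {j. j = k \<and> E i k} = of_bool (E i k)"
      by auto
    ultimately have *: "card ({j. E i j} \<inter> {j. k = j \<or> E j k})
        = of_bool (E i k) + card {j. E i j \<and> E j k}"
      by simp
    \<comment> \<open>For \<open>k = i\<close> the walks of length 2 go out and back, so their
      number is the degree of \<open>i\<close>. It is odd, and the parity condition therefore
      absorbs the disjunct \<open>k = i\<close>.\<close>
    have "{j. E i j \<and> E j i} = {j. E i j}"
      using sympD[OF assms(1)] by blast
    then have "neighborhood_rel E i k \<longleftrightarrow> odd (of_bool (E i k) + card {j. E i j \<and> E j k})"
      using assms(2,3) by (cases "k = i") (auto simp: neighborhood_rel_def vertex_degree_def irreflp_def)
    then show ?thesis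
      using * by (simp add: sum_of_bool_eq of_nat_bit_eq del: add_bit_eq_xor)
  qed
  then show ?thesis
    by (simp add: vec_eq_iff)
qed

theorem theorem6:
  fixes E :: "'n::finite \<Rightarrow> 'n \<Rightarrow> bool"
  assumes "simple_graph E"
    and "(\<forall>v. odd (vertex_degree E v)) \<or> (\<forall>v. even (vertex_degree E v))"
  shows "(\<forall>x :: bit ^ 'n. transformable (neighborhood_press E) x (x + (\<chi> v. 1))) \<and>
    ((\<forall>v. odd (vertex_degree E v)) \<longrightarrow>
      (\<forall>i f :: bit ^ 'n. transformable (neighborhood_press E) i f \<longrightarrow>
        transformable (original_press E) i f))"
proof (intro conjI allI impI)
  have E: "symp E" "irreflp E"
    using assms(1) by (auto simp: simple_graph_def)
  note press = neighborhood_press_eq[OF E(2)] original_press_eq transformable_toggle_iff mem_Collect_eq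
  have "reflp (neighborhood_rel E)"
    by (auto simp: neighborhood_rel_def reflp_def)
  then have "(\<chi> v. 1) \<in> vec.span (range (\<lambda>i. (\<chi> k. of_bool (neighborhood_rel E i k)) :: bit ^ 'n))"
    using symp_neighborhood_rel[OF E(1)] by (intro all_ones_in_span)
  then show "transformable (neighborhood_press E) x (x + (\<chi> v. 1))" for x
    unfolding press by simp
  show "transformable (original_press E) i f"
    if odd: "\<forall>v. odd (vertex_degree E v)" and "transformable (neighborhood_press E) i f" for i f
  proof -
    let ?V = "vec.span (range (\<lambda>j. (\<chi> k. of_bool (k = j \<or> E j k)) :: bit ^ 'n))"
    \<comment> \<open>It suffices to simulate single neighborhood presses; the span of their vectors
      then lies in \<open>?V\<close> too.\<close>
    have "(\<chi> k. of_bool (neighborhood_rel E i k)) \<in> ?V" for i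
      unfolding neighborhood_vector_eq_sum[OF E odd[rule_format]]
      by (rule vec.span_sum) (rule vec.span_base, rule rangeI)
    then have "range (\<lambda>i. \<chi> k. of_bool (neighborhood_rel E i k)) \<subseteq> ?V"
      by blast
    then have "vec.span (range (\<lambda>i. \<chi> k. of_bool (neighborhood_rel E i k))) \<subseteq> ?V"
      by (rule vec.span_minimal) (rule vec.subspace_span)
    then show ?thesis
      using that(2) unfolding press by blast
  qed
qed

end
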